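(* Let $\triangle ABC$ be a triangle with a right angle at $C$ and side lengths $a = BC$, $b = CA$, $c = AB$ (opposite to $A$, $B$ and $C$, respectively). Then for each angle $\theta$ with $60^{\circ} \leq \theta \leq 135^{\circ}$, the sum of the areas of the $(a,\theta)$-ziggurat and the $(b,\theta)$-ziggurat equals the area of the $(c,\theta)$-ziggurat.
   Context: For $\ell > 0$ and $60^{\circ} \leq \theta < 180^{\circ}$, an $(\ell,\theta)$-ziggurat is the isosceles trapezium in the Euclidean plane having a base of length $\ell$ and both "nonparallel" (lateral) sides of length $\ell$, with both interior angles at the endpoints of this base equal to $\theta$; it is determined up to congruence by $\ell$ and $\theta$. For $\theta = 90^{\circ}$ it is a square of side $\ell$. For $\theta = 60^{\circ}$ it degenerates to an equilateral triangle of side $\ell$ (the side opposite to the base has length $0$). *)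

theory Defs
  imports "HOL-Analysis.Analysis"
begin

text \<open>The unoriented angle at the vertex \<open>Y\<close>, in radians. If \<open>Y\<close> coincides with \<open>X\<close> or \<open>Z\<close>,
  division by zero gives the junk value \<open>pi / 2\<close>.\<close>

definition angle_at :: "real^2 \<Rightarrow> real^2 \<Rightarrow> real^2 \<Rightarrow> real" where
  "angle_at X Y Z = arccos (((X - Y) \<bullet> (Z - Y)) / (norm (X - Y) * norm (Z - Y)))"

text \<open>\<open>Z\<close> is the closed region bounded by a trapezium with vertices \<open>P, Q, R, S\<close> in cyclic order,
  base \<open>PQ\<close>, opposite parallel side \<open>SR\<close> and lateral sides \<open>PS\<close>, \<open>QR\<close>. The scalar \<open>t\<close> is the ratio
  of the parallel sides: \<open>t \<ge> 0\<close> makes the quadrilateral convex and not self-crossing, and \<open>t = 0\<close>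
  is the degenerate case of an equilateral triangle.\<close>

definition is_ziggurat :: "real \<Rightarrow> real \<Rightarrow> (real^2) set \<Rightarrow> bool" where
  "is_ziggurat l \<theta> Z \<longleftrightarrow>
     0 < l \<and> pi / 3 \<le> \<theta> \<and> \<theta> < pi \<and>
     (\<exists>P Q R S.
        dist P Q = l \<and> dist P S = l \<and> dist Q R = l \<and>
        angle_at Q P S = \<theta> \<and> angle_at P Q R = \<theta> \<and>
        (\<exists>t\<ge>0. R - S = t *\<^sub>R (Q - P)) \<and>
        Z = convex hull {P, Q, R, S})"

lemma is_ziggurat_exists:
  assumes "0 < l" "pi / 3 \<le> \<theta>" "\<theta> < pi"
  shows "\<exists>Z. is_ziggurat l \<theta> Z"
proof -
  define P Q R S :: "real^2" where "P = vector [0, 0]" and "Q = vector [l, 0]"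
    and "R = vector [l - l * cos \<theta>, l * sin \<theta>]" and "S = vector [l * cos \<theta>, l * sin \<theta>]"
  note defs = P_def Q_def R_def S_def
  have th: "0 \<le> \<theta>" "\<theta> \<le> pi" using assms pi_gt_zero by linarith+
  have "cos \<theta> \<le> cos (pi / 3)"
    using assms pi_gt_zero by (intro cos_monotone_0_pi_le) auto
  then have c: "0 \<le> 1 - 2 * cos \<theta>" by (simp add: cos_60)
  have sq: "sqrt ((l * cos \<theta>)\<^sup>2 + (l * sin \<theta>)\<^sup>2) = l"
  proof -
    have "(l * cos \<theta>)\<^sup>2 + (l * sin \<theta>)\<^sup>2 = l\<^sup>2 * ((cos \<theta>)\<^sup>2 + (sin \<theta>)\<^sup>2)"
      by (simp only: power_mult_distrib distrib_left)
    then show ?thesis using assms(1) by simp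
  qed
  have norms: "norm (Q - P) = l" "norm (P - Q) = l" "norm (S - P) = l" "norm (R - Q) = l"
    using assms(1) sq unfolding defs norm_vec_def L2_set_def by (simp_all add: sum_2)
  have dists: "dist P Q = l" "dist P S = l" "dist Q R = l"
    using norms by (simp_all add: dist_norm norm_minus_commute)
  have inner: "(Q - P) \<bullet> (S - P) = l * l * cos \<theta>" "(P - Q) \<bullet> (R - Q) = l * l * cos \<theta>"
    unfolding defs inner_vec_def by (simp_all add: sum_2)
  have angles: "angle_at Q P S = \<theta>" "angle_at P Q R = \<theta>"
    unfolding angle_at_def norms inner using assms(1) th by (simp_all add: arccos_cos)
  have "R - S = (1 - 2 * cos \<theta>) *\<^sub>R (Q - P)"
    unfolding defs vec_eq_iff forall_2 by (simp add: algebra_simps)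
  with c dists angles assms show ?thesis unfolding is_ziggurat_def by blast
qed

end

theory Submission
  imports Defs
begin

text \<open>In the affine frame spanned by the base and one lateral side, every ziggurat of angle \<open>\<theta>\<close> is
  the image of the same quadrilateral, and the frame has determinant \<open>\<plusminus> l\<^sup>2 sin \<theta>\<close>. Hence the area of
  an \<open>(l, \<theta>)\<close>-ziggurat is \<open>l\<^sup>2\<close> times a quantity depending only on \<open>\<theta>\<close>, and the claim is the
  theorem of Pythagoras. The area of the quadrilateral itself is never needed.\<close>

text \<open>By Cauchy-Schwarz the quotient lies in [-1, 1], where \<open>cos\<close> inverts
  \<open>arccos\<close>. If \<open>Y\<close> coincides with \<open>X\<close> or \<open>Z\<close>,
  both sides are 0, whatever the junk value of \<open>angle_at\<close>.\<close>

lemma inner_eq_cos_angle_at: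
  "(X - Y) \<bullet> (Z - Y) = norm (X - Y) * norm (Z - Y) * cos (angle_at X Y Z)"
proof (cases "X = Y \<or> Z = Y")
  case False
  define N where "N = norm (X - Y) * norm (Z - Y)"
  have N: "N > 0" using False by (simp add: N_def)
  have "\<bar>((X - Y) \<bullet> (Z - Y)) / N\<bar> \<le> 1"
    using N Cauchy_Schwarz_ineq2[of "X - Y" "Z - Y"] by (simp add: N_def)
  then have "cos (angle_at X Y Z) = ((X - Y) \<bullet> (Z - Y)) / N"
    by (simp add: angle_at_def N_def cos_arccos_abs)
  then show ?thesis using N by (simp add: N_def)
qed auto

text \<open>The factor is the area of the parallelogram spanned by \<open>u\<close> and
  \<open>v\<close>, written as the root of their Gram determinant because lengths and angles are
  what is known of a ziggurat.\<close>

lemma measure_affine_image_2: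
  fixes P u v :: "real^2" and S :: "(real^2) set"
  assumes "S \<in> lmeasurable"
  shows "measure lebesgue ((\<lambda>x. P + (x$1 *\<^sub>R u + x$2 *\<^sub>R v)) ` S)
    = sqrt ((norm u)\<^sup>2 * (norm v)\<^sup>2 - (u \<bullet> v)\<^sup>2) * measure lebesgue S"
proof -
  let ?L = "\<lambda>x::real^2. x$1 *\<^sub>R u + x$2 *\<^sub>R v"
  have lin: "linear ?L"
    by (rule linearI) (simp_all add: algebra_simps)
  have "det (matrix ?L) = u$1 * v$2 - v$1 * u$2"
    by (simp add: det_2 matrix_def axis_def)
  \<comment> \<open>Lagrange's identity in the plane.\<close>
  moreover have "(u$1 * v$2 - v$1 * u$2)\<^sup>2 = (norm u)\<^sup>2 * (norm v)\<^sup>2 - (u \<bullet> v)\<^sup>2"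
    unfolding power2_norm_eq_inner inner_vec_def
    by (simp add: sum_2 power2_eq_square algebra_simps)
  ultimately have "\<bar>det (matrix ?L)\<bar> = sqrt ((norm u)\<^sup>2 * (norm v)\<^sup>2 - (u \<bullet> v)\<^sup>2)"
    by (metis real_sqrt_abs)
  moreover have "(\<lambda>x. P + ?L x) ` S = (+) P ` (?L ` S)"
    by (simp add: image_image)
  ultimately show ?thesis
    by (simp only: measure_translation measure_linear_image[OF lin assms])
qed

text \<open>The vertices \<open>P, Q, R, S\<close> in coordinates with origin \<open>P\<close> and
  basis \<open>Q - P\<close>, \<open>S - P\<close>.\<close>

definition affine_ziggurat :: "real \<Rightarrow> (real^2) set" where
  "affine_ziggurat \<theta> =
     convex hull {vector [0, 0], vector [1, 0], vector [1 - 2 * cos \<theta>, 1], vector [0, 1]}"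

lemma measure_ziggurat:
  assumes "is_ziggurat l \<theta> Z"
  shows "measure lebesgue Z = l\<^sup>2 * (\<bar>sin \<theta>\<bar> * measure lebesgue (affine_ziggurat \<theta>))"
proof -
  from assms obtain P Q R S t where l: "0 < l"
    and d: "dist P Q = l" "dist P S = l" "dist Q R = l"
    and ang: "angle_at Q P S = \<theta>" "angle_at P Q R = \<theta>"
    and RS: "R - S = t *\<^sub>R (Q - P)" and Z: "Z = convex hull {P, Q, R, S}"
    unfolding is_ziggurat_def by blast
  define u v where "u = Q - P" and "v = S - P"
  have norms: "norm u = l" "norm v = l" "norm (P - Q) = l" "norm (R - Q) = l"
    using d by (simp_all add: u_def v_def dist_norm norm_minus_commute)
  have uv: "u \<bullet> v = l\<^sup>2 * cos \<theta>"
    using inner_eq_cos_angle_at[of Q P S] ang norms by (simp add: u_def v_def power2_eq_square)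
  have pts: "Q = P + u" "S = P + v" "R = P + (t *\<^sub>R u + v)"
    using RS by (simp_all add: u_def v_def algebra_simps)
  \<comment> \<open>The angle at \<open>Q\<close> fixes the ratio \<open>t\<close> of the parallel
    sides: the inner product there is computed from the frame and again from the angle.\<close>
  have "P - Q = - u" "R - Q = v + (t - 1) *\<^sub>R u"
    by (simp_all add: pts algebra_simps)
  then have "(P - Q) \<bullet> (R - Q) = - (l\<^sup>2 * cos \<theta>) - (t - 1) * l\<^sup>2"
    using uv norms by (simp add: inner_right_distrib dot_square_norm)
  moreover have "(P - Q) \<bullet> (R - Q) = l\<^sup>2 * cos \<theta>"
    using inner_eq_cos_angle_at[of P Q R] ang norms by (simp add: power2_eq_square)
  ultimately have "l\<^sup>2 * (t - (1 - 2 * cos \<theta>)) = 0"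
    by (simp add: algebra_simps)
  then have t: "t = 1 - 2 * cos \<theta>" using l by simp
  let ?L = "\<lambda>x::real^2. x$1 *\<^sub>R u + x$2 *\<^sub>R v"
  let ?V = "{vector [0, 0], vector [1, 0], vector [1 - 2 * cos \<theta>, 1], vector [0, 1]} :: (real^2) set"
  have lin: "linear ?L"
    by (rule linearI) (simp_all add: algebra_simps)
  \<comment> \<open>The frame map sends model vertices to vertices of \<open>Z\<close>, and affine
    maps commute with convex hulls.\<close>
  have "Z = convex hull ((+) P ` ?L ` ?V)"
    by (simp add: Z pts t)
  also have "\<dots> = (+) P ` ?L ` affine_ziggurat \<theta>"
    by (simp only: convex_hull_translation convex_hull_linear_image[OF lin] affine_ziggurat_def)
  finally have "Z = (\<lambda>x. P + ?L x) ` affine_ziggurat \<theta>"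
    by (simp add: image_image)
  moreover have "affine_ziggurat \<theta> \<in> lmeasurable"
    unfolding affine_ziggurat_def
    by (intro lmeasurable_compact finite_imp_compact_convex_hull) simp
  ultimately have "measure lebesgue Z =
      sqrt (l\<^sup>2 * l\<^sup>2 - (l\<^sup>2 * cos \<theta>)\<^sup>2) * measure lebesgue (affine_ziggurat \<theta>)"
    by (simp only: measure_affine_image_2 norms uv)
  also have "l\<^sup>2 * l\<^sup>2 - (l\<^sup>2 * cos \<theta>)\<^sup>2 = (l\<^sup>2 * sin \<theta>)\<^sup>2"
    unfolding power_mult_distrib sin_squared_eq by (simp add: power2_eq_square algebra_simps)
  finally show ?thesis by (simp add: abs_mult)
qed

lemma pythagoras_angle_at:
  assumes "angle_at A C B = pi / 2"
  shows "(dist B C)\<^sup>2 + (dist C A)\<^sup>2 = (dist A B)\<^sup>2"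
proof -
  have "(A - C) \<bullet> (B - C) = 0"
    using inner_eq_cos_angle_at[of A C B] assms by simp
  moreover have "A - B = (A - C) - (B - C)" by simp
  \<comment> \<open>By polarization the inner product is half of the difference between the two
    sides, so its vanishing is this equation.\<close>
  ultimately have "(norm (A - B))\<^sup>2 = (norm (A - C))\<^sup>2 + (norm (B - C))\<^sup>2"
    by (metis dot_norm_neg diff_zero eq_iff_diff_eq_0 divide_eq_0_iff zero_neq_numeral)
  then show ?thesis by (simp add: dist_norm norm_minus_commute)
qed

theorem theoremA:
  fixes A B C :: "real^2" and a b c \<theta> :: real and Za Zb Zc :: "(real^2) set"
  assumes "\<not> collinear {A, B, C}"
    and "angle_at A C B = pi / 2"
    and "a = dist B C" and "b = dist C A" and "c = dist A B"
    and "pi / 3 \<le> \<theta>" and "\<theta> \<le> 3 * pi / 4"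
    and "is_ziggurat a \<theta> Za" and "is_ziggurat b \<theta> Zb" and "is_ziggurat c \<theta> Zc"
  shows "measure lebesgue Za + measure lebesgue Zb = measure lebesgue Zc"
proof -
  have "a\<^sup>2 + b\<^sup>2 = c\<^sup>2"
    using pythagoras_angle_at[OF assms(2)] assms(3-5) by simp
  then show ?thesis
    \<comment> \<open>Distributivity, read backwards, collects the common factor of the areas and
      exposes \<open>a\<^sup>2 + b\<^sup>2\<close>.\<close>
    by (simp only: measure_ziggurat[OF assms(8)] measure_ziggurat[OF assms(9)]
        measure_ziggurat[OF assms(10)] flip: distrib_right)
qed

end
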